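(* Let $G$ be a solvable group generated by a finite set $X$, and let $A$ be a normal abelian subgroup of $G$ such that $G/A$ satisfies the maximal condition for normal subgroups. Then $\mathrm{pw}(G,X)<\infty$.
   Context: For a group $G$ generated by a set $X$, a palindrome is an element of $G$ represented by a reduced word in the alphabet $X^{\pm1}$ that reads the same forwards and backwards. The palindromic length $l_{\mathcal P}(g)$ of $g\in G$ is the minimal $k$ such that $g$ is a product of $k$ palindromes, and the palindromic width is $\mathrm{pw}(G,X)=\sup_{g\in G} l_{\mathcal P}(g)$. A group satisfies the maximal condition for normal subgroups if every normal subgroup is the normal closure of a finite subset. *)

theory Defs
  imports "HOL-Algebra.Algebra" "HOL-Library.Extended_Nat"
begin

definition letter_val :: "('g, 'b) monoid_scheme \<Rightarrow> bool \<times> 'g \<Rightarrow> 'g" where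
  "letter_val G l = (if fst l then snd l else inv\<^bsub>G\<^esub> (snd l))"

definition word_val :: "('g, 'b) monoid_scheme \<Rightarrow> (bool \<times> 'g) list \<Rightarrow> 'g" where
  "word_val G w = foldr (\<lambda>l acc. letter_val G l \<otimes>\<^bsub>G\<^esub> acc) w \<one>\<^bsub>G\<^esub>"

definition reduced_word :: "(bool \<times> 'g) list \<Rightarrow> bool" where
  "reduced_word w = (\<forall>i. Suc i < length w \<longrightarrow>
      \<not> (snd (w ! i) = snd (w ! Suc i) \<and> fst (w ! i) \<noteq> fst (w ! Suc i)))"

definition palindromes :: "('g, 'b) monoid_scheme \<Rightarrow> 'g set \<Rightarrow> 'g set" where
  "palindromes G S = {g. \<exists>w. g = word_val G w \<and> set (map snd w) \<subseteq> S \<and> reduced_word w \<and> rev w = w}"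

text \<open>Palindromic length (infinity if g is not a product of palindromes).\<close>
definition pal_length :: "('g, 'b) monoid_scheme \<Rightarrow> 'g set \<Rightarrow> 'g \<Rightarrow> enat" where
  "pal_length G S g = (INF k \<in> {k. \<exists>ps. length ps = k \<and> set ps \<subseteq> palindromes G S
        \<and> g = foldr (monoid.mult G) ps (monoid.one G)}. enat k)"

definition pal_width :: "('g, 'b) monoid_scheme \<Rightarrow> 'g set \<Rightarrow> enat" where
  "pal_width G S = (SUP g \<in> carrier G. pal_length G S g)"

definition normal_closure :: "('g, 'b) monoid_scheme \<Rightarrow> 'g set \<Rightarrow> 'g set" where
  "normal_closure G F = \<Inter> {N. normal N G \<and> F \<subseteq> N}"

definition max_normal :: "('g, 'b) monoid_scheme \<Rightarrow> bool" where
  "max_normal G = (\<forall>N. normal N G \<longrightarrow>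
      (\<exists>F. finite F \<and> F \<subseteq> carrier G \<and> N = normal_closure G F))"

end

(* With w' the reversal of a word w, the identity [x, w] = x * (w x^-1 w') * (w'^-1 w^-1) shows that
   every commutator [x, g] with x a generator is a product of three palindromes; hence for each fixed
   g the set of all [g, c] has bounded palindromic length. Along the preimages N of the derived series
   of G/A one maintains a subgroup M of N of bounded palindromic length with [G, N] contained in M.
   For N = A (more generally for N abelian modulo a bounded subgroup) the maps a -> [x, a] are
   homomorphisms, so [G, N] is the product of their images. To pass from Z to the preceding term N,
   which is the normal closure of Z and finitely many elements y, note that Z is central modulo M,
   so c -> [y, c] is a homomorphism from N to Z/M and [N, N] is bounded by the product of the images;
   then N is abelian modulo a bounded subgroup. Finally G/[G, G] is a product of finitely many cyclic
   groups, and powers of generators are palindromes. *)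

theory Submission
  imports Defs
begin

section \<open>Palindromic words\<close>

text \<open>Index-free form of reducedness, which splits along Cons and append; this is what lets
  reduced words be extended or trimmed at both ends.\<close>

lemma reduced_word_iff_successively:
  "reduced_word w \<longleftrightarrow> successively (\<lambda>a b. \<not> (snd a = snd b \<and> fst a \<noteq> fst b)) w"
  unfolding reduced_word_def
proof (induction w)
  case (Cons a w)
  have split: "(\<forall>i. P i) \<longleftrightarrow> P 0 \<and> (\<forall>i. P (Suc i))" for P :: "nat \<Rightarrow> bool"
    by (metis not0_implies_Suc)
  show ?case
    by (subst split) (use Cons in \<open>auto simp: successively_Cons hd_conv_nth\<close>)
qed simp

lemma successively_sandwich:
  "v \<noteq> [] \<Longrightarrow> successively P (l # v @ [m]) \<longleftrightarrow> P l (hd v) \<and> successively P v \<and> P (last v) m"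
  by (auto simp: successively_Cons successively_append_iff)

lemma palindrome_cases:
  assumes "rev w = w"
  obtains "w = []" | l where "w = [l]" | l u where "w = l # u @ [l]" "rev u = u"
proof (cases w)
  case Nil
  then show thesis by (rule that(1))
next
  case (Cons l v)
  show thesis
  proof (cases v rule: rev_cases)
    case Nil
    then show thesis using Cons by (intro that(2)[of l]) simp
  next
    case (snoc u m)
    have eq: "rev (l # u @ [m]) = l # u @ [m]"
      using assms unfolding Cons snoc .
    have "m = l" using arg_cong[OF eq, of hd] by simp
    moreover from eq this have "rev u = u" by simp
    ultimately show thesis
      using Cons snoc by (intro that(3)[of l u]) simp_all
  qed
qed

definition inv_word :: "(bool \<times> 'a) list \<Rightarrow> (bool \<times> 'a) list" where
  "inv_word w = rev (map (map_prod Not id) w)"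

text \<open>The reason why inverses of palindromes are palindromes and why
  \<open>inv_word (rev w) @ inv_word w\<close> is symmetric.\<close>

lemma rev_inv_word: "rev (inv_word w) = inv_word (rev w)"
  by (simp add: inv_word_def rev_map)

lemma set_inv_word [simp]: "snd ` set (inv_word w) = snd ` set w"
  by (auto simp: inv_word_def image_image)

context group
begin

lemma inv_mult_cancel_left [simp]:
  "\<lbrakk>x \<in> carrier G; y \<in> carrier G\<rbrakk> \<Longrightarrow> inv x \<otimes> (x \<otimes> y) = y"
  "\<lbrakk>x \<in> carrier G; y \<in> carrier G\<rbrakk> \<Longrightarrow> x \<otimes> (inv x \<otimes> y) = y"
  by (simp_all add: m_assoc[symmetric])

lemma letter_val_closed [simp]: "snd l \<in> carrier G \<Longrightarrow> letter_val G l \<in> carrier G"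
  by (simp add: letter_val_def)

lemma word_val_Nil [simp]: "word_val G [] = \<one>"
  by (simp add: word_val_def)

lemma word_val_Cons [simp]: "word_val G (l # w) = letter_val G l \<otimes> word_val G w"
  by (simp add: word_val_def)

lemma word_val_closed [simp]: "snd ` set w \<subseteq> carrier G \<Longrightarrow> word_val G w \<in> carrier G"
  by (induction w) auto

lemma word_val_append [simp]:
  "\<lbrakk>snd ` set u \<subseteq> carrier G; snd ` set v \<subseteq> carrier G\<rbrakk>
    \<Longrightarrow> word_val G (u @ v) = word_val G u \<otimes> word_val G v"
  by (induction u) (auto simp: m_assoc)

lemma letter_val_Not: "snd l \<in> carrier G \<Longrightarrow> letter_val G (map_prod Not id l) = inv (letter_val G l)"
  by (cases l) (simp add: letter_val_def)

lemma word_val_inv_word [simp]: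
  "snd ` set w \<subseteq> carrier G \<Longrightarrow> word_val G (inv_word w) = inv (word_val G w)"
proof (induction w)
  case (Cons l w)
  moreover have "inv_word (l # w) = inv_word w @ [map_prod Not id l]"
    by (simp add: inv_word_def)
  ultimately show ?case
    by (simp add: letter_val_Not inv_mult_group)
qed (simp add: inv_word_def)

text \<open>A cancellation at one end of a palindrome is mirrored at the other end, so both can be
  carried out without destroying the symmetry.\<close>

lemma palindrome_reduce:
  assumes "rev w = w" "snd ` set w \<subseteq> carrier G"
  shows "\<exists>v. rev v = v \<and> reduced_word v \<and> snd ` set v \<subseteq> snd ` set w \<and> word_val G v = word_val G w"
  using assms
proof (induction w rule: length_induct)
  case (1 w)
  from \<open>rev w = w\<close> show ?case
  proof (cases rule: palindrome_cases)
    case 1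
    then show ?thesis by (intro exI[of _ w]) (simp add: reduced_word_def)
  next
    case (2 l)
    then show ?thesis by (intro exI[of _ w]) (simp add: reduced_word_def)
  next
    case (3 l u)
    with "1.prems" have l: "snd l \<in> carrier G" and u: "snd ` set u \<subseteq> carrier G" by auto
    have "length u < length w" using 3 by simp
    with "1.IH" 3(2) u obtain v where v: "rev v = v" "reduced_word v"
      "snd ` set v \<subseteq> snd ` set u" "word_val G v = word_val G u"
      by blast
    have vc: "snd ` set v \<subseteq> carrier G" using v u by blast
    \<comment> \<open>The only letter that cancels against \<open>l\<close>. As \<open>v\<close> is
      symmetric, it starts with \<open>l'\<close> exactly when it ends with \<open>l'\<close>, which
      gives the case split below.\<close>
    define l' where "l' = map_prod Not id l"
    have l': "letter_val G l' = inv (letter_val G l)" "snd l' = snd l" "fst l' \<noteq> fst l"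
      using l by (simp_all add: l'_def letter_val_Not)
    have eq: "word_val G w = letter_val G l \<otimes> word_val G v \<otimes> letter_val G l"
      using u l by (simp add: 3(1) v(4) m_assoc)
    have cancels: "a = l'" if "snd l = snd a" "fst l \<noteq> fst a" for a
    proof (rule prod_eqI)
      show "fst a = fst l'" using that l'(3) by blast
      show "snd a = snd l'" using that l'(2) by metis
    qed
    show ?thesis
    proof (cases "v \<noteq> [] \<and> hd v = l'")
      case False
      have "last v = hd v" using v(1) by (metis hd_rev)
      have *: "snd l = snd (hd v) \<longrightarrow> fst l = fst (hd v)" if "v \<noteq> []"
        using False cancels that by blast
      have "reduced_word (l # v @ [l])"
      proof (cases "v = []")
        case True
        then show ?thesis by (simp add: reduced_word_iff_successively)
      next
        case False
        then show ?thesis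
          unfolding reduced_word_iff_successively successively_sandwich[OF False] \<open>last v = hd v\<close>
          using *[OF False] v(2)[unfolded reduced_word_iff_successively] by metis
      qed
      have "word_val G (l # v @ [l]) = word_val G w"
        using vc l by (simp add: eq m_assoc)
      moreover have "snd ` set (l # v @ [l]) \<subseteq> snd ` set w"
        using 3(1) v(3) by auto
      moreover have "rev (l # v @ [l]) = l # v @ [l]"
        using v(1) by simp
      ultimately show ?thesis
        using \<open>reduced_word (l # v @ [l])\<close> by (intro exI[of _ "l # v @ [l]"] conjI) assumption+
    next
      case True
      from v(1) show ?thesis
      proof (cases rule: palindrome_cases)
        case 1
        then show ?thesis using True by simp
      next
        \<comment> \<open>Here \<open>v\<close> is the single letter \<open>l'\<close>; it cancels
          only one of the two outer letters and leaves \<open>[l]\<close>.\<close>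
        case (2 m)
        then have "word_val G w = word_val G [l]"
          using True l l' eq by simp
        moreover have "snd ` set [l] \<subseteq> snd ` set w" using 3(1) by simp
        ultimately show ?thesis
          by (intro exI[of _ "[l]"]) (simp add: reduced_word_def)
      next
        \<comment> \<open>Both outer letters cancel against the ends of \<open>v\<close>; the middle
          segment \<open>t\<close> inherits symmetry and reducedness from \<open>v\<close>.\<close>
        case A: (3 m t)
        then have m: "m = l'" and t: "snd ` set t \<subseteq> snd ` set v" using True by auto
        have "word_val G v = letter_val G l' \<otimes> (word_val G t \<otimes> letter_val G l')"
          using vc t l by (simp add: A(1) m l'(2))
        then have "word_val G t = word_val G w"
          unfolding eq using l l'(1) t vc by (simp add: m_assoc)
        moreover have "reduced_word t"
          using v(2) unfolding A reduced_word_iff_successively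
          by (cases "t = []") (simp_all add: successively_sandwich)
        moreover have "snd ` set t \<subseteq> snd ` set w"
          using t v(3) 3(1) by auto
        ultimately show ?thesis
          using A(2) by (intro exI[of _ t] conjI) assumption+
      qed
    qed
  qed
qed

end

section \<open>Sets of bounded palindromic length\<close>

definition (in group) comm :: "'a \<Rightarrow> 'a \<Rightarrow> 'a" where
  "comm x y = x \<otimes> y \<otimes> inv x \<otimes> inv y"

locale fg_group = group +
  fixes S :: "'a set"
  assumes finite_gens: "finite S"
    and gens_subset: "S \<subseteq> carrier G"
    and gens_generate: "generate G S = carrier G"
begin

text \<open>By symmetric cancellation, reducedness need never be checked again: any symmetric word
  over the generators will do.\<close>

lemma palindromesI:
  assumes "rev w = w" "snd ` set w \<subseteq> S"
  shows "word_val G w \<in> palindromes G S"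
proof -
  obtain v where "rev v = v" "reduced_word v" "snd ` set v \<subseteq> snd ` set w"
    "word_val G v = word_val G w"
    using palindrome_reduce assms gens_subset by (metis subset_trans)
  then show ?thesis
    unfolding palindromes_def using assms by (auto intro!: exI[of _ v])
qed

lemma palindromes_closed: "p \<in> palindromes G S \<Longrightarrow> p \<in> carrier G"
  using gens_subset by (auto simp: palindromes_def)

lemma palindromes_inv: "p \<in> palindromes G S \<Longrightarrow> inv p \<in> palindromes G S"
proof -
  assume "p \<in> palindromes G S"
  then obtain w where w: "p = word_val G w" "snd ` set w \<subseteq> S" "rev w = w"
    by (auto simp: palindromes_def)
  then have "inv p = word_val G (inv_word w)"
    using gens_subset by (subst word_val_inv_word) auto
  then show ?thesis
    using w palindromesI[of "inv_word w"] by (simp add: rev_inv_word)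
qed

lemma carrier_word:
  assumes "g \<in> carrier G"
  obtains w where "g = word_val G w" "snd ` set w \<subseteq> S"
proof -
  have "g \<in> generate G S" using assms gens_generate by simp
  then have "\<exists>w. g = word_val G w \<and> snd ` set w \<subseteq> S"
  proof induction
    case one
    show ?case by (intro exI[of _ "[]"]) simp
  next
    case (incl x)
    then show ?case using gens_subset
      by (intro exI[of _ "[(True, x)]"]) (auto simp: letter_val_def)
  next
    case (inv x)
    then show ?case using gens_subset
      by (intro exI[of _ "[(False, x)]"]) (auto simp: letter_val_def)
  next
    case (eng x y)
    then obtain u v where "x = word_val G u" "y = word_val G v" "snd ` set u \<subseteq> S" "snd ` set v \<subseteq> S"
      by blast
    then show ?case using gens_subset
      by (intro exI[of _ "u @ v"]) auto
  qed
  with that show thesis by blast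
qed

text \<open>At most \<open>k\<close> factors rather than exactly \<open>k\<close>, so that one
  \<open>k\<close> can serve a whole set in \<open>pal_bounded\<close>.\<close>

definition pal_product :: "nat \<Rightarrow> 'a \<Rightarrow> bool" where
  "pal_product k g \<longleftrightarrow>
    (\<exists>ps. length ps \<le> k \<and> set ps \<subseteq> palindromes G S \<and> g = foldr (\<otimes>) ps \<one>)"

definition pal_bounded :: "'a set \<Rightarrow> bool" where
  "pal_bounded T \<longleftrightarrow> (\<exists>k. \<forall>t\<in>T. pal_product k t)"

lemma foldr_mult_closed [simp]: "set ps \<subseteq> carrier G \<Longrightarrow> foldr (\<otimes>) ps \<one> \<in> carrier G"
  by (induction ps) auto

lemma foldr_mult_append:
  "\<lbrakk>set ps \<subseteq> carrier G; set qs \<subseteq> carrier G\<rbrakk>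
    \<Longrightarrow> foldr (\<otimes>) (ps @ qs) \<one> = foldr (\<otimes>) ps \<one> \<otimes> foldr (\<otimes>) qs \<one>"
  by (induction ps) (auto simp: m_assoc simp del: foldr_append)

lemma foldr_mult_inv:
  "set ps \<subseteq> carrier G \<Longrightarrow> inv (foldr (\<otimes>) ps \<one>) = foldr (\<otimes>) (map (m_inv G) (rev ps)) \<one>"
proof (induction ps)
  case (Cons p ps)
  have "foldr (\<otimes>) (map (m_inv G) (rev ps) @ [inv p]) \<one>
      = foldr (\<otimes>) (map (m_inv G) (rev ps)) \<one> \<otimes> foldr (\<otimes>) [inv p] \<one>"
    using Cons.prems by (intro foldr_mult_append) auto
  then show ?case using Cons by (simp add: inv_mult_group del: foldr_append)
qed simp

lemma pal_product_palindrome: "p \<in> palindromes G S \<Longrightarrow> pal_product 1 p"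
  unfolding pal_product_def by (intro exI[of _ "[p]"]) (auto simp: palindromes_closed)

lemma pal_product_mult:
  assumes "pal_product k g" "pal_product l h"
  shows "pal_product (k + l) (g \<otimes> h)"
proof -
  obtain ps qs where "length ps \<le> k" "length qs \<le> l"
    and pq: "set ps \<subseteq> palindromes G S" "set qs \<subseteq> palindromes G S"
    "g = foldr (\<otimes>) ps \<one>" "h = foldr (\<otimes>) qs \<one>"
    using assms unfolding pal_product_def by blast
  moreover from pq have "g \<otimes> h = foldr (\<otimes>) (ps @ qs) \<one>"
    using palindromes_closed by (subst foldr_mult_append) auto
  ultimately show ?thesis
    unfolding pal_product_def by (intro exI[of _ "ps @ qs"]) auto
qed

lemma pal_product_inv:
  assumes "pal_product k g"
  shows "pal_product k (inv g)"
proof -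
  obtain ps where ps: "length ps \<le> k" "set ps \<subseteq> palindromes G S" "g = foldr (\<otimes>) ps \<one>"
    using assms unfolding pal_product_def by blast
  then have "inv g = foldr (\<otimes>) (map (m_inv G) (rev ps)) \<one>"
    using palindromes_closed by (subst ps(3), intro foldr_mult_inv) auto
  then show ?thesis
    using ps palindromes_inv unfolding pal_product_def
    by (intro exI[of _ "map (m_inv G) (rev ps)"]) auto
qed

lemma pal_bounded_subset: "\<lbrakk>pal_bounded T; U \<subseteq> T\<rbrakk> \<Longrightarrow> pal_bounded U"
  unfolding pal_bounded_def by blast

lemma pal_bounded_one: "pal_bounded {\<one>}"
  unfolding pal_bounded_def pal_product_def by (intro exI[of _ 0]) simp

lemma pal_bounded_set_mult: "\<lbrakk>pal_bounded T; pal_bounded U\<rbrakk> \<Longrightarrow> pal_bounded (T <#> U)"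
  unfolding pal_bounded_def set_mult_def using pal_product_mult by blast

lemma pal_bounded_inv: "pal_bounded T \<Longrightarrow> pal_bounded (m_inv G ` T)"
  unfolding pal_bounded_def using pal_product_inv by blast

text \<open>A natural power of a generator is the value of a constant word, which is symmetric; with
  inverses, one palindrome suffices for every element.\<close>

lemma pal_bounded_generate_single:
  assumes "x \<in> S"
  shows "pal_bounded (generate G {x})"
proof -
  have x: "x \<in> carrier G" using assms gens_subset by blast
  have "x [^] n \<in> palindromes G S" for n :: nat
  proof -
    have "word_val G (replicate n (True, x)) = x [^] n"
    proof (induction n)
      case (Suc n)
      have "word_val G (replicate (Suc n) (True, x)) = x \<otimes> x [^] n"
        using Suc by (simp add: letter_val_def)
      then show ?case using nat_pow_Suc2[OF x, of n] by metis
    qed simp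
    moreover have "word_val G (replicate n (True, x)) \<in> palindromes G S"
      using assms by (intro palindromesI) auto
    ultimately show ?thesis by simp
  qed
  then have "x [^] k \<in> palindromes G S" for k :: int
    using palindromes_inv by (auto simp only: int_pow_def2 split: if_split)
  then have "pal_product 1 t" if "t \<in> generate G {x}" for t
    using that pal_product_palindrome unfolding generate_pow[OF x] by auto
  then show ?thesis
    unfolding pal_bounded_def by blast
qed

section \<open>Commutators\<close>

lemma comm_closed [simp]: "\<lbrakk>x \<in> carrier G; y \<in> carrier G\<rbrakk> \<Longrightarrow> comm x y \<in> carrier G"
  by (simp add: comm_def)

text \<open>The conjugation is moved into the second argument, where it stays inside any normal
  subgroup; conjugating the commutator itself could destroy bounds on palindromic length.\<close>

lemma comm_mult_left:
  "\<lbrakk>x \<in> carrier G; y \<in> carrier G; c \<in> carrier G\<rbrakk>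
    \<Longrightarrow> comm (x \<otimes> y) c = comm x (y \<otimes> c \<otimes> inv y) \<otimes> comm y c"
  by (simp add: comm_def m_assoc inv_mult_group)

lemma comm_inv_left:
  "\<lbrakk>x \<in> carrier G; c \<in> carrier G\<rbrakk> \<Longrightarrow> comm (inv x) c = inv (comm x (inv x \<otimes> c \<otimes> x))"
  by (simp add: comm_def m_assoc inv_mult_group)

text \<open>The middle factor is the defect of \<open>c \<mapsto> comm x c\<close> from being a
  homomorphism; it vanishes modulo any subgroup containing the commutators of \<open>c\<close> with
  the values of the map.\<close>

lemma comm_mult_right:
  "\<lbrakk>x \<in> carrier G; c \<in> carrier G; d \<in> carrier G\<rbrakk>
    \<Longrightarrow> comm x (c \<otimes> d) = comm x c \<otimes> comm c (comm x d) \<otimes> comm x d"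
  by (simp add: comm_def m_assoc inv_mult_group)

text \<open>The case \<open>d = inv c\<close> of \<open>comm_mult_right\<close>: up to the defect,
  the image is closed under inverses.\<close>

lemma comm_inv_right:
  "\<lbrakk>x \<in> carrier G; c \<in> carrier G\<rbrakk>
    \<Longrightarrow> inv (comm x c) = comm c (comm x (inv c)) \<otimes> comm x (inv c)"
  by (simp add: comm_def m_assoc inv_mult_group)

lemma comm_conj:
  "\<lbrakk>g \<in> carrier G; x \<in> carrier G; c \<in> carrier G\<rbrakk>
    \<Longrightarrow> comm (g \<otimes> x \<otimes> inv g) c = g \<otimes> comm x (inv g \<otimes> c \<otimes> g) \<otimes> inv g"
  by (simp add: comm_def m_assoc inv_mult_group)

lemma comm_inv_flip: "\<lbrakk>x \<in> carrier G; y \<in> carrier G\<rbrakk> \<Longrightarrow> inv (comm x y) = comm y x"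
  by (simp add: comm_def m_assoc inv_mult_group)

lemma conj_eq_comm_mult:
  "\<lbrakk>x \<in> carrier G; y \<in> carrier G\<rbrakk> \<Longrightarrow> x \<otimes> y \<otimes> inv x = comm x y \<otimes> y"
  by (simp add: comm_def m_assoc inv_mult_group)

lemma pal_product_comm_generator:
  assumes "x \<in> S" "c \<in> carrier G"
  shows "pal_product 3 (comm x c)"
proof -
  have x: "x \<in> carrier G" using assms gens_subset by blast
  obtain w where w: "c = word_val G w" "snd ` set w \<subseteq> S"
    using carrier_word assms by metis
  have wc: "snd ` set w \<subseteq> carrier G" using w gens_subset by blast
  \<comment> \<open>With \<open>c'\<close> the value of the reversed word, the commutator is
    \<open>x * (c * inv x * c') * (inv c' * inv c)\<close>.\<close>
  let ?u = "w @ [(False, x)] @ rev w" and ?v = "inv_word (rev w) @ inv_word w"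
  have "pal_product (1 + (1 + 1)) (word_val G [(True, x)] \<otimes> (word_val G ?u \<otimes> word_val G ?v))"
    using assms w
    by (intro pal_product_mult pal_product_palindrome palindromesI)
      (simp_all add: rev_inv_word image_Un del: word_val_append word_val_Cons)
  moreover have "word_val G [(True, x)] \<otimes> (word_val G ?u \<otimes> word_val G ?v) = comm x c"
    using x wc w(1) by (simp add: letter_val_def comm_def m_assoc)
  ultimately show ?thesis by (simp add: eval_nat_numeral)
qed

text \<open>Extends the bound from generators by the identities for inverses and products on the
  left. The bound may depend on \<open>g\<close>.\<close>

lemma pal_bounded_comm:
  assumes "g \<in> carrier G"
  shows "pal_bounded (comm g ` carrier G)"
proof -
  have "g \<in> generate G S" using assms gens_generate by simp
  then show ?thesis
  proof induction
    case one
    have "comm \<one> ` carrier G \<subseteq> {\<one>}" by (auto simp: comm_def)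
    then show ?case using pal_bounded_one pal_bounded_subset by blast
  next
    case (incl x)
    then show ?case
      unfolding pal_bounded_def using pal_product_comm_generator by blast
  next
    case (inv x)
    then have x: "x \<in> carrier G" using gens_subset by blast
    have "pal_bounded (comm x ` carrier G)"
      unfolding pal_bounded_def using pal_product_comm_generator inv by blast
    moreover have "comm (inv x) ` carrier G \<subseteq> m_inv G ` comm x ` carrier G"
      using x by (auto simp: comm_inv_left)
    ultimately show ?case
      using pal_bounded_inv pal_bounded_subset by blast
  next
    case (eng x y)
    then have "x \<in> carrier G" "y \<in> carrier G" using gens_generate by auto
    then have "comm (x \<otimes> y) ` carrier G \<subseteq> (comm x ` carrier G) <#> (comm y ` carrier G)"
      unfolding set_mult_def by (force simp: comm_mult_left)
    then show ?case
      using eng pal_bounded_set_mult pal_bounded_subset by blast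
  qed
qed

section \<open>Bounded subgroups built from commutator images\<close>

lemma normalI_comm:
  assumes "subgroup R G" "\<And>g r. \<lbrakk>g \<in> carrier G; r \<in> R\<rbrakk> \<Longrightarrow> comm g r \<in> R"
  shows "R \<lhd> G"
  unfolding normal_inv_iff
proof (intro conjI ballI assms(1))
  fix g r assume gr: "g \<in> carrier G" "r \<in> R"
  then have "comm g r \<otimes> r \<in> R" by (intro subgroup.m_closed[OF assms(1)] assms(2))
  then show "g \<otimes> r \<otimes> inv g \<in> R"
    using gr subgroup.mem_carrier[OF assms(1)] by (simp add: conj_eq_comm_mult)
qed

text \<open>\<open>N\<close> normalises \<open>R\<close>, and by \<open>central\<close> the defect
  of \<open>c \<mapsto> comm y c\<close> lies in \<open>R\<close>. So on \<open>N\<close> this map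
  is a homomorphism modulo \<open>R\<close>, and its image times \<open>R\<close> is a
  subgroup.\<close>

lemma commutator_layer_insert:
  assumes N: "subgroup N G" and R: "subgroup R G" and VN: "V \<subseteq> N"
    and y: "y \<in> carrier G" "\<And>c. c \<in> N \<Longrightarrow> comm y c \<in> V"
    and central: "\<And>n v. \<lbrakk>n \<in> N; v \<in> V\<rbrakk> \<Longrightarrow> comm n v \<in> R" and RV: "R \<subseteq> V"
  shows "subgroup (comm y ` N <#> R) G"
proof (rule subgroupI)
  interpret N: subgroup N G by (rule N)
  interpret R: subgroup R G by (rule R)
  have c: "comm y n \<in> N" "comm y n \<in> carrier G" "n \<in> carrier G" if "n \<in> N" for n
    using that y(2) VN N.subset by blast+
  \<comment> \<open>\<open>N\<close> normalises \<open>R\<close>: since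
    \<open>R \<subseteq> V\<close>, \<open>central\<close> puts \<open>comm (inv n) r\<close> into
    \<open>R\<close>.\<close>
  have conj: "inv n \<otimes> r \<otimes> n \<in> R" if "n \<in> N" "r \<in> R" for n r
  proof -
    have "comm (inv n) r \<otimes> r \<in> R"
      using that RV central by (intro R.m_closed) auto
    then show ?thesis
      using conj_eq_comm_mult[of "inv n" r] that by simp
  qed
  have prodI: "comm y n \<otimes> r \<in> comm y ` N <#> R" if "n \<in> N" "r \<in> R" for n r
    using that unfolding set_mult_def by blast
  show "comm y ` N <#> R \<subseteq> carrier G"
    using c(2) R.subset by (intro setmult_subset_G) blast+
  show "comm y ` N <#> R \<noteq> {}"
    using N.one_closed R.one_closed unfolding set_mult_def by blast
  fix a assume "a \<in> comm y ` N <#> R"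
  then obtain d r where d: "d \<in> N" and r: "r \<in> R" and a: "a = comm y d \<otimes> r"
    unfolding set_mult_def by blast
  show "inv a \<in> comm y ` N <#> R"
  proof -
    let ?e = "comm y (inv d)"
    \<comment> \<open>The defect at the pair \<open>d\<close>, \<open>inv d\<close>.\<close>
    define k where "k = comm d ?e"
    have k: "k \<in> R" unfolding k_def using d y(2) central N.m_inv_closed by blast
    have e: "?e \<in> N" using c(1) d N.m_inv_closed by blast
    have "inv (comm y d) = k \<otimes> ?e"
      unfolding k_def using d y(1) by (intro comm_inv_right) simp_all
    then have "inv a = inv r \<otimes> (k \<otimes> ?e)"
      using c(2)[OF d] r by (simp add: a inv_mult_group)
    also have "\<dots> = ?e \<otimes> (inv ?e \<otimes> (inv r \<otimes> k) \<otimes> ?e)"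
      using e r k by (simp add: m_assoc)
    finally show ?thesis
      using prodI[OF N.m_inv_closed[OF d] conj[OF e]] r k by simp
  qed
  fix b assume "b \<in> comm y ` N <#> R"
  then obtain f t where f: "f \<in> N" and t: "t \<in> R" and b: "b = comm y f \<otimes> t"
    unfolding set_mult_def by blast
  define k where "k = comm d (comm y f)"
  have k: "k \<in> R" unfolding k_def using d f y(2) central by blast
  \<comment> \<open>Chosen so that \<open>comm y (d \<otimes> f) \<otimes> ?s\<close> equals
    \<open>a \<otimes> b\<close>: it removes the defect \<open>k\<close> and moves \<open>r\<close>
    past \<open>comm y f\<close>, at the price of a conjugation.\<close>
  let ?s = "inv (comm y f) \<otimes> (inv k \<otimes> r) \<otimes> comm y f \<otimes> t"
  have eq: "comm y (d \<otimes> f) \<otimes> ?s = a \<otimes> b"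
  proof -
    have "comm y (d \<otimes> f) = comm y d \<otimes> k \<otimes> comm y f"
      unfolding k_def using d f y(1) by (intro comm_mult_right) simp_all
    then show ?thesis
      using r t k c(2)[OF d] c(2)[OF f] by (simp add: a b m_assoc)
  qed
  have "?s \<in> R"
    using conj[OF c(1)[OF f], of "inv k \<otimes> r"] k r t by simp
  then show "a \<otimes> b \<in> comm y ` N <#> R"
    unfolding eq[symmetric] using N.m_closed[OF d f] by (rule prodI[rotated])
qed

text \<open>Modulo \<open>K\<close>, each map \<open>c \<mapsto> [y, c]\<close> is a homomorphism from \<open>N\<close> into a central subgroup
  of \<open>N\<close>, so that its image is a subgroup and a product of such images is again one.\<close>

lemma commutator_layer:
  assumes N: "subgroup N G" and K: "subgroup K G" and KV: "K \<subseteq> V" and VN: "V \<subseteq> N"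
    and V: "subgroup V G"
    and bounded: "pal_bounded K"
    and central: "\<And>n v. \<lbrakk>n \<in> N; v \<in> V\<rbrakk> \<Longrightarrow> comm n v \<in> K"
    and Y: "finite Y" "Y \<subseteq> carrier G" "\<And>y c. \<lbrakk>y \<in> Y; c \<in> N\<rbrakk> \<Longrightarrow> comm y c \<in> V"
  obtains R where "subgroup R G" "K \<subseteq> R" "R \<subseteq> V" "pal_bounded R"
    "\<And>y c. \<lbrakk>y \<in> Y; c \<in> N\<rbrakk> \<Longrightarrow> comm y c \<in> R"
proof -
  have "\<exists>R. subgroup R G \<and> K \<subseteq> R \<and> R \<subseteq> V \<and> pal_bounded R \<and> (\<forall>y\<in>Y. \<forall>c\<in>N. comm y c \<in> R)"
    using Y
  proof (induction rule: finite_induct)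
    case empty
    then show ?case using K KV bounded by blast
  next
    case (insert y Y)
    then obtain R where R: "subgroup R G" "K \<subseteq> R" "R \<subseteq> V" "pal_bounded R"
      "\<forall>y\<in>Y. \<forall>c\<in>N. comm y c \<in> R"
      by auto
    interpret R: subgroup R G by (rule R(1))
    interpret N: subgroup N G by (rule N)
    interpret V: subgroup V G by (rule V)
    have y: "y \<in> carrier G" "\<And>c. c \<in> N \<Longrightarrow> comm y c \<in> V" using insert.prems by auto
    let ?R = "comm y ` N <#> R"
    have "subgroup ?R G"
      using commutator_layer_insert[OF N R(1) VN y] central R(2,3) by blast
    moreover have "comm y c \<in> ?R" if "c \<in> N" for c
    proof -
      have "comm y c \<otimes> \<one> \<in> ?R" using that R.one_closed unfolding set_mult_def by blast
      then show ?thesis using that y by simp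
    qed
    moreover have "R \<subseteq> ?R"
    proof
      fix r assume r: "r \<in> R"
      have "comm y \<one> \<otimes> r \<in> ?R" using r N.one_closed unfolding set_mult_def by blast
      then show "r \<in> ?R" using r y by (simp add: comm_def)
    qed
    moreover have "?R \<subseteq> V"
      using y R(3) by (auto simp: set_mult_def)
    \<comment> \<open>Each element of \<open>Y\<close> costs one more bounded factor, so a finite
      \<open>Y\<close> keeps the bound finite.\<close>
    moreover have "pal_bounded ?R"
      using pal_bounded_comm[OF y(1)] R(4) N.subset
      by (intro pal_bounded_set_mult) (auto intro: pal_bounded_subset)
    ultimately show ?case
      using R(2,5) by (intro exI[of _ ?R]) auto
  qed
  with that show thesis by blast
qed

section \<open>Normal subgroups that are central modulo a bounded subgroup\<close>

lemma comm_subgroup_generators: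
  assumes R: "subgroup R G" and N: "N \<lhd> G"
    and gens: "\<And>x c. \<lbrakk>x \<in> S; c \<in> N\<rbrakk> \<Longrightarrow> comm x c \<in> R"
    and g: "g \<in> carrier G" and c: "c \<in> N"
  shows "comm g c \<in> R"
proof -
  interpret N: normal N G by (rule N)
  interpret R: subgroup R G by (rule R)
  have "g \<in> generate G S" using g gens_generate by simp
  then have "\<forall>c\<in>N. comm g c \<in> R"
  proof induction
    case one
    then show ?case by (simp add: comm_def)
  next
    case (incl x)
    then show ?case using gens by blast
  next
    case (inv x)
    then have x: "x \<in> carrier G" using gens_subset by blast
    \<comment> \<open>The induction hypothesis ranges over all of \<open>N\<close> because the
      left-hand identities conjugate \<open>c\<close>, and normality keeps the conjugate in
      \<open>N\<close>.\<close>
    then have "comm x (inv x \<otimes> c \<otimes> x) \<in> R" if "c \<in> N" for c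
      using gens inv that N.inv_op_closed1 by blast
    then show ?case using x by (auto simp: comm_inv_left)
  next
    case (eng x y)
    then have "x \<in> carrier G" "y \<in> carrier G" using gens_generate by auto
    then show ?case using eng N.inv_op_closed2 by (auto simp: comm_mult_left)
  qed
  with c show ?thesis by blast
qed

text \<open>The invariant carried along the series: such an \<open>M\<close> is normal in
  \<open>G\<close>, and \<open>N/M\<close> lies in the center of \<open>G/M\<close>.\<close>

definition bounded_over_center :: "'a set \<Rightarrow> bool" where
  "bounded_over_center N \<longleftrightarrow>
    (\<exists>M. subgroup M G \<and> M \<subseteq> N \<and> pal_bounded M \<and> (\<forall>g\<in>carrier G. \<forall>n\<in>N. comm g n \<in> M))"

text \<open>The case \<open>V = N\<close>, \<open>Y = S\<close> of \<open>commutator_layer\<close>: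
  modulo \<open>K\<close> all of \<open>N\<close> is abelian, so the images of the maps
  \<open>c \<mapsto> comm x c\<close>, one for each generator \<open>x\<close>, multiply to a
  bounded subgroup.\<close>

lemma bounded_over_center_abelian:
  assumes N: "N \<lhd> G" and K: "subgroup K G" "K \<subseteq> N" "pal_bounded K"
    and abelian: "\<And>a b. \<lbrakk>a \<in> N; b \<in> N\<rbrakk> \<Longrightarrow> comm a b \<in> K"
  shows "bounded_over_center N"
proof -
  interpret N: normal N G by (rule N)
  have "comm x c \<in> N" if "x \<in> S" "c \<in> N" for x c
    using that gens_subset N.inv_op_closed2 unfolding comm_def by blast
  then obtain R where R: "subgroup R G" "K \<subseteq> R" "R \<subseteq> N" "pal_bounded R"
    "\<And>x c. \<lbrakk>x \<in> S; c \<in> N\<rbrakk> \<Longrightarrow> comm x c \<in> R"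
    using commutator_layer[OF N.subgroup_axioms K(1,2) order_refl N.subgroup_axioms K(3)
        abelian finite_gens gens_subset] by metis
  then show ?thesis
    unfolding bounded_over_center_def using comm_subgroup_generators[OF R(1) N] by blast
qed

text \<open>First the layer with \<open>V = Z\<close>, \<open>Y = F\<close> bounds the commutators
  of \<open>F\<close> with \<open>N\<close>; then normal generation spreads this to all commutators
  within \<open>N\<close>, and the abelian case applies. The assumption \<open>generated\<close>
  says that \<open>Z\<close> and \<open>F\<close> together generate \<open>N\<close> as a normal
  subgroup.\<close>

lemma bounded_over_center_step:
  assumes N: "N \<lhd> G" and Z: "Z \<lhd> G" and ZN: "Z \<subseteq> N" and bZ: "bounded_over_center Z"
    and abelian: "\<And>a b. \<lbrakk>a \<in> N; b \<in> N\<rbrakk> \<Longrightarrow> comm a b \<in> Z"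
    and F: "finite F" "F \<subseteq> N"
    and generated: "\<And>T. \<lbrakk>T \<lhd> G; Z \<subseteq> T; F \<subseteq> T\<rbrakk> \<Longrightarrow> N \<subseteq> T"
  shows "bounded_over_center N"
proof -
  interpret N: normal N G by (rule N)
  interpret Z: normal Z G by (rule Z)
  obtain M where M: "subgroup M G" "M \<subseteq> Z" "pal_bounded M"
    and central: "\<And>g z. \<lbrakk>g \<in> carrier G; z \<in> Z\<rbrakk> \<Longrightarrow> comm g z \<in> M"
    using bZ unfolding bounded_over_center_def by blast
  have "F \<subseteq> carrier G" using F(2) N.subset by blast
  moreover have "comm n v \<in> M" if "n \<in> N" "v \<in> Z" for n v
    using that central N.subset by blast
  moreover have "comm y c \<in> Z" if "y \<in> F" "c \<in> N" for y c
    using that abelian F(2) by blast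
  ultimately obtain R where R: "subgroup R G" "M \<subseteq> R" "R \<subseteq> Z" "pal_bounded R"
    "\<And>y c. \<lbrakk>y \<in> F; c \<in> N\<rbrakk> \<Longrightarrow> comm y c \<in> R"
    using commutator_layer[OF N.subgroup_axioms M(1,2) ZN Z.subgroup_axioms M(3) _ F(1)] by metis
  \<comment> \<open>\<open>R\<close> lies between \<open>M\<close> and \<open>Z\<close>, and
    commutators of \<open>G\<close> with \<open>Z\<close> fall into \<open>M\<close>.\<close>
  interpret R: normal R G
    using normalI_comm[OF R(1)] central R(2,3) by blast
  \<comment> \<open>The preimage in \<open>N\<close> of the center of \<open>N/R\<close>; once it is
    normal and contains \<open>Z\<close> and \<open>F\<close>, it is all of
    \<open>N\<close>.\<close>
  define T where "T = {b \<in> N. \<forall>c\<in>N. comm b c \<in> R}"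
  have "T \<lhd> G"
    unfolding normal_inv_iff
  proof (intro conjI ballI subgroupI)
    show "T \<subseteq> carrier G" using N.subset by (auto simp: T_def)
    have "\<one> \<in> T" by (simp add: T_def comm_def)
    then show "T \<noteq> {}" by blast
  next
    fix a assume a: "a \<in> T"
    then have "inv a \<otimes> c \<otimes> a \<in> N" if "c \<in> N" for c
      using that by (simp add: T_def)
    then show "inv a \<in> T"
      using a by (auto simp: T_def comm_inv_left)
  next
    fix a b assume ab: "a \<in> T" "b \<in> T"
    then have "b \<otimes> c \<otimes> inv b \<in> N" if "c \<in> N" for c
      using that by (simp add: T_def)
    then show "a \<otimes> b \<in> T"
      using ab by (auto simp: T_def comm_mult_left)
  next
    fix g a assume g: "g \<in> carrier G" and a: "a \<in> T"
    have "comm (g \<otimes> a \<otimes> inv g) c \<in> R" if c: "c \<in> N" for c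
    proof -
      have "comm a (inv g \<otimes> c \<otimes> g) \<in> R"
        using a c g N.inv_op_closed1 by (auto simp: T_def)
      then show ?thesis
        using a c g R.inv_op_closed2 by (auto simp: T_def comm_conj)
    qed
    then show "g \<otimes> a \<otimes> inv g \<in> T"
      using a g N.inv_op_closed2 by (auto simp: T_def)
  qed
  moreover have "Z \<subseteq> T"
  proof
    fix z assume z: "z \<in> Z"
    have "comm z c \<in> R" if c: "c \<in> N" for c
    proof -
      have "comm c z \<in> R" using c z central R(2) by auto
      then have "inv (comm c z) \<in> R" by simp
      then show ?thesis using c z by (simp add: comm_inv_flip)
    qed
    then show "z \<in> T" using z ZN by (auto simp: T_def)
  qed
  moreover have "F \<subseteq> T"
    using F(2) R(5) by (auto simp: T_def)
  ultimately have "N \<subseteq> T" by (rule generated)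
  then have "comm a b \<in> R" if "a \<in> N" "b \<in> N" for a b
    using that by (auto simp: T_def)
  then show ?thesis
    using bounded_over_center_abelian[OF N R(1) _ R(4)] R(3) ZN by blast
qed

section \<open>From the invariant for the whole group to finite palindromic width\<close>

lemma pal_bounded_carrier:
  assumes "bounded_over_center (carrier G)"
  shows "pal_bounded (carrier G)"
proof -
  obtain M where M: "subgroup M G" "pal_bounded M"
    and comm: "\<And>g h. \<lbrakk>g \<in> carrier G; h \<in> carrier G\<rbrakk> \<Longrightarrow> comm g h \<in> M"
    using assms unfolding bounded_over_center_def by blast
  \<comment> \<open>The generators are adjoined to \<open>M\<close> one at a time, each through its
    cyclic subgroup.\<close>
  have "\<exists>R. subgroup R G \<and> M \<subseteq> R \<and> Y \<subseteq> R \<and> pal_bounded R" if "Y \<subseteq> S" for Y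
    using finite_subset[OF that finite_gens] that
  proof (induction rule: finite_induct)
    case empty
    then show ?case using M by blast
  next
    case (insert y Y)
    then obtain R where R: "subgroup R G" "M \<subseteq> R" "Y \<subseteq> R" "pal_bounded R" by auto
    have RG: "R \<subseteq> carrier G" using R(1) subgroup.subset by blast
    have y: "y \<in> S" "y \<in> carrier G" using insert.prems gens_subset by auto
    \<comment> \<open>All commutators of \<open>G\<close> lie in \<open>M\<close>, so every subgroup
      above \<open>M\<close> is normal and its product with a cyclic subgroup is again a
      subgroup.\<close>
    have "R \<lhd> G"
      using normalI_comm[OF R(1)] comm R(2) RG by blast
    let ?H = "generate G {y}"
    have H: "subgroup ?H G" using y by (intro generate_is_subgroup) simp
    have "subgroup (R <#> ?H) G"
      using mult_norm_subgroup[OF \<open>R \<lhd> G\<close> H] .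
    moreover have "R \<subseteq> R <#> ?H"
    proof
      fix r assume r: "r \<in> R"
      then have "r \<otimes> \<one> \<in> R <#> ?H"
        using subgroup.one_closed[OF H] unfolding set_mult_def by blast
      then show "r \<in> R <#> ?H" using r RG by auto
    qed
    moreover have "y \<in> R <#> ?H"
    proof -
      have "\<one> \<otimes> y \<in> R <#> ?H"
        using subgroup.one_closed[OF R(1)] generate.incl[of y "{y}" G]
        unfolding set_mult_def by blast
      then show ?thesis using y by simp
    qed
    moreover have "pal_bounded (R <#> ?H)"
      using R(4) pal_bounded_generate_single[OF y(1)] by (rule pal_bounded_set_mult)
    ultimately show ?case using R(2,3) by (intro exI[of _ "R <#> ?H"]) auto
  qed
  then obtain R where "subgroup R G" "S \<subseteq> R" "pal_bounded R" by blast
  then show ?thesis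
    using generate_subgroup_incl[of S R] gens_generate pal_bounded_subset by metis
qed

lemma pal_width_finite:
  assumes "pal_bounded (carrier G)"
  shows "pal_width G S < \<infinity>"
proof -
  obtain k where k: "\<And>g. g \<in> carrier G \<Longrightarrow> pal_product k g"
    using assms unfolding pal_bounded_def by blast
  have "pal_length G S g \<le> enat k" if g: "g \<in> carrier G" for g
  proof -
    obtain ps where ps: "length ps \<le> k" "set ps \<subseteq> palindromes G S" "g = foldr (\<otimes>) ps \<one>"
      using k[OF g] unfolding pal_product_def by blast
    then have "pal_length G S g \<le> enat (length ps)"
      unfolding pal_length_def by (intro INF_lower) blast
    also have "\<dots> \<le> enat k" using ps(1) by simp
    finally show ?thesis .
  qed
  then have "pal_width G S \<le> enat k"
    unfolding pal_width_def by (rule SUP_least)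
  also have "\<dots> < \<infinity>" by simp
  finally show ?thesis .
qed

section \<open>Transfer between the quotient by \<open>A\<close> and the group\<close>

lemma FactGroup_lift_generators:
  assumes A: "A \<lhd> G" and max: "max_normal (G Mod A)" and D: "D \<lhd> (G Mod A)"
  obtains C where "finite C" "C \<subseteq> \<Union>D"
    "\<And>T. \<lbrakk>T \<lhd> G; A \<subseteq> T; C \<subseteq> T\<rbrakk> \<Longrightarrow> \<Union>D \<subseteq> T"
proof -
  interpret A: normal A G by (rule A)
  interpret Q: group "G Mod A" by (rule A.factorgroup_is_group)
  interpret q: group_hom G "G Mod A" "\<lambda>x. A #> x"
    by (intro group_hom.intro group_hom_axioms.intro is_group Q.is_group A.r_coset_hom_Mod)
  have surj: "(\<lambda>x. A #> x) ` carrier G = carrier (G Mod A)"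
    by (auto simp: FactGroup_def RCOSETS_def)
  \<comment> \<open>Elements of the quotient are cosets, so the union of \<open>D\<close> is its
    preimage under the projection.\<close>
  have UD: "\<Union>D = {x \<in> carrier G. A #> x \<in> D}"
    using A.factgroup_subgroup_union_char[OF normal_imp_subgroup[OF D]] .
  obtain F where F: "finite F" "F \<subseteq> carrier (G Mod A)" "D = normal_closure (G Mod A) F"
    using max D unfolding max_normal_def by blast
  \<comment> \<open>Coset representatives of finitely many normal generators of
    \<open>D\<close>.\<close>
  then obtain C where C: "C \<subseteq> carrier G" "finite C" "F = (\<lambda>x. A #> x) ` C"
    using surj finite_subset_image by metis
  have "F \<subseteq> D" unfolding F(3) normal_closure_def by blast
  then have "C \<subseteq> \<Union>D" unfolding UD using C by blast
  moreover have "\<Union>D \<subseteq> T" if T: "T \<lhd> G" "A \<subseteq> T" "C \<subseteq> T" for T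
  proof
    interpret T: normal T G by (rule T(1))
    fix b assume "b \<in> \<Union>D"
    then have b: "b \<in> carrier G" "A #> b \<in> D" unfolding UD by auto
    \<comment> \<open>The image of \<open>T\<close> is normal and contains \<open>F\<close>, so it
      is one of the sets intersected in the normal closure. Since \<open>A \<subseteq> T\<close>,
      the inclusion then lifts back to \<open>G\<close>.\<close>
    have "(\<lambda>x. A #> x) ` T \<lhd> (G Mod A)"
      using T.surj_hom_normal_subgroup[OF q.group_hom_axioms surj] .
    then have "D \<subseteq> (\<lambda>x. A #> x) ` T"
      unfolding F(3) normal_closure_def using C(3) T(3) by blast
    with b(2) obtain t where t: "t \<in> T" "A #> b = A #> t" by blast
    then have "b \<in> A #> t"
      using rcos_self[OF b(1) A.subgroup_axioms] by simp
    then obtain a where "a \<in> A" "b = a \<otimes> t" unfolding r_coset_def by blast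
    then show "b \<in> T" using t(1) T(2) by blast
  qed
  ultimately show thesis using that C(2) by blast
qed

text \<open>One step up the derived series: \<open>bounded_over_center_step\<close> with the
  preimages of \<open>D\<close> and of its derived subgroup as \<open>N\<close> and
  \<open>Z\<close>, the finite set coming from the maximal condition.\<close>

lemma bounded_over_center_derived_FactGroup:
  assumes A: "A \<lhd> G" and max: "max_normal (G Mod A)" and D: "D \<lhd> (G Mod A)"
    and bounded: "bounded_over_center (\<Union>(derived (G Mod A) D))"
  shows "bounded_over_center (\<Union>D)"
proof -
  interpret A: normal A G by (rule A)
  interpret Q: group "G Mod A" by (rule A.factorgroup_is_group)
  interpret q: group_hom G "G Mod A" "\<lambda>x. A #> x"
    by (intro group_hom.intro group_hom_axioms.intro is_group Q.is_group A.r_coset_hom_Mod)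
  let ?E = "derived (G Mod A) D"
  have E: "?E \<lhd> (G Mod A)" by (rule Q.derived_is_normal[OF D])
  have UD: "\<Union>D = {x \<in> carrier G. A #> x \<in> D}"
    using A.factgroup_subgroup_union_char[OF normal_imp_subgroup[OF D]] .
  have UE: "\<Union>?E = {x \<in> carrier G. A #> x \<in> ?E}"
    using A.factgroup_subgroup_union_char[OF normal_imp_subgroup[OF E]] .
  have "A \<in> ?E"
    using subgroup.one_closed[OF normal_imp_subgroup[OF E]] by simp
  then have AE: "A \<subseteq> \<Union>?E" by blast
  have "?E \<subseteq> D" by (rule Q.derived_incl[OF order_refl normal_imp_subgroup[OF D]])
  then have "\<Union>?E \<subseteq> \<Union>D" by blast
  moreover have "comm a b \<in> \<Union>?E" if ab: "a \<in> \<Union>D" "b \<in> \<Union>D" for a b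
  proof -
    have c: "a \<in> carrier G" "b \<in> carrier G" "A #> a \<in> D" "A #> b \<in> D"
      using ab unfolding UD by auto
    \<comment> \<open>The projection sends a commutator to the commutator of the cosets, which is
      one of the generators of the derived subgroup.\<close>
    have "A #> comm a b = (A #> a) \<otimes>\<^bsub>G Mod A\<^esub> (A #> b)
        \<otimes>\<^bsub>G Mod A\<^esub> inv\<^bsub>G Mod A\<^esub> (A #> a) \<otimes>\<^bsub>G Mod A\<^esub> inv\<^bsub>G Mod A\<^esub> (A #> b)"
      using c(1,2) by (simp only: comm_def q.hom_mult q.hom_inv inv_closed m_closed)
    then have "A #> comm a b \<in> derived_set (G Mod A) D" using c(3,4) by blast
    then show ?thesis
      unfolding UE unfolding derived_def using c(1,2) by (simp add: generate.incl)
  qed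
  moreover obtain C where "finite C" "C \<subseteq> \<Union>D"
    and C: "\<And>T. \<lbrakk>T \<lhd> G; A \<subseteq> T; C \<subseteq> T\<rbrakk> \<Longrightarrow> \<Union>D \<subseteq> T"
    using FactGroup_lift_generators[OF A max D] by metis
  moreover have "\<Union>D \<subseteq> T" if "T \<lhd> G" "\<Union>?E \<subseteq> T" "C \<subseteq> T" for T
    using C[OF that(1) _ that(3)] AE that(2) by blast
  ultimately show ?thesis
    using bounded_over_center_step[OF A.factgroup_subgroup_union_normal[OF D]
        A.factgroup_subgroup_union_normal[OF E] _ bounded] by metis
qed

end

theorem theorem1p1:
  fixes G :: "('g, 'b) monoid_scheme" and S :: "'g set" and A :: "'g set"
  assumes "group G"
    and "solvable G"
    and "finite S" and "S \<subseteq> carrier G" and "generate G S = carrier G"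
    and "A \<lhd> G" and "comm_group (G\<lparr>carrier := A\<rparr>)"
    and "max_normal (G Mod A)"
  shows "pal_width G S < \<infinity>"
proof -
  interpret fg_group G S
    using assms by (intro fg_group.intro fg_group_axioms.intro)
  interpret A: normal A G by (rule assms(6))
  interpret Q: group "G Mod A" by (rule A.factorgroup_is_group)
  interpret q: group_hom G "G Mod A" "\<lambda>x. A #>\<^bsub>G\<^esub> x"
    by (intro group_hom.intro group_hom_axioms.intro is_group Q.is_group A.r_coset_hom_Mod)
  have carrierQ: "(\<lambda>x. A #>\<^bsub>G\<^esub> x) ` carrier G = carrier (G Mod A)"
    by (auto simp: FactGroup_def RCOSETS_def)
  have "solvable (G Mod A)"
    using q.surj_hom_imp_solvable[OF carrierQ assms(2)] .
  then obtain n where n: "(derived (G Mod A) ^^ n) (carrier (G Mod A)) = {\<one>\<^bsub>G Mod A\<^esub>}"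
    unfolding Q.solvable_iff_trivial_derived_seq by blast
  define D where "D i = (derived (G Mod A) ^^ i) (carrier (G Mod A))" for i
  have D_Suc: "D (Suc i) = derived (G Mod A) (D i)" for i by (simp add: D_def)
  have D_normal: "D i \<lhd> (G Mod A)" for i
  proof (induction i)
    case 0
    then show ?case using Q.normal_self by (simp add: D_def)
  next
    case (Suc i)
    then show ?case unfolding D_Suc by (rule Q.derived_is_normal)
  qed
  \<comment> \<open>Base of the induction: \<open>A\<close> is abelian, so the trivial subgroup
    serves as \<open>K\<close>.\<close>
  have "comm a b \<in> {\<one>\<^bsub>G\<^esub>}" if "a \<in> A" "b \<in> A" for a b
  proof -
    have "a \<otimes>\<^bsub>G\<^esub> b = b \<otimes>\<^bsub>G\<^esub> a"
      using comm_groupE(4)[OF assms(7)] that by simp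
    then show ?thesis using that by (simp add: comm_def m_assoc)
  qed
  then have "bounded_over_center A"
    using bounded_over_center_abelian[OF assms(6) triv_subgroup _ pal_bounded_one] A.one_closed
    by blast
  \<comment> \<open>The last term is trivial; its only element is the coset
    \<open>A\<close>.\<close>
  moreover have "\<Union>(D n) = A"
    unfolding D_def n by simp
  ultimately have "bounded_over_center (\<Union>(D n))" by simp
  then have "bounded_over_center (\<Union>(D 0))"
  \<comment> \<open>The invariant for \<open>D (Suc i)\<close> passes to \<open>D i\<close>, so
    lowering the index climbs from \<open>A\<close> to the whole group.\<close>
  proof (induction n)
    case (Suc i)
    then show ?case
      using bounded_over_center_derived_FactGroup[OF assms(6,8) D_normal] unfolding D_Suc by blast
  qed
  moreover have "\<Union>(D 0) = carrier G"
    using A.factgroup_subgroup_union_char[OF Q.subgroup_self] carrierQ by (auto simp: D_def)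
  ultimately show ?thesis
    using pal_bounded_carrier pal_width_finite by simp
qed

end
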